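(* Let $(L,[\cdot,\cdot],\alpha)$ be a multiplicative Hom-Lie superalgebra over $\mathbf K$. Then $$\mathrm{GDer}(L)=\mathrm{QDer}(L)+\mathrm{QC}(L).$$
   Context: $\mathbf K$ is a field of characteristic zero. For a $\mathbb Z_2$-graded space $V$, $\mathrm{hg}(V)$ is the set of homogeneous elements, and in exponents of $-1$ a homogeneous element or map stands for its degree. A Hom-Lie superalgebra $(L,[\cdot,\cdot],\alpha)$ is a $\mathbb Z_2$-graded space $L=L_{\bar 0}\oplus L_{\bar 1}$ with an even bilinear map $[\cdot,\cdot]:L\times L\to L$ and an even linear map $\alpha:L\to L$ such that for homogeneous $x,y,z$: $[x,y]=-(-1)^{xy}[y,x]$ and $(-1)^{zx}[\alpha(x),[y,z]]+(-1)^{xy}[\alpha(y),[z,x]]+(-1)^{yz}[\alpha(z),[x,y]]=0$. It is multiplicative if $\alpha[x,y]=[\alpha x,\alpha y]$ for all $x,y\in L$. $\mathrm{End}(L)$ is the $\mathbb Z_2$-graded space of all linear maps $L\to L$, with $\mathrm{End}_\theta(L)$ the maps homogeneous of degree $\theta$. For $k\ge 0$ define the following graded subspaces of $\mathrm{End}(L)$, each spanned by the homogeneous $D\in\mathrm{End}_\theta(L)$ ($\theta\in\mathbb Z_2$) satisfying $D\alpha=\alpha D$ and the stated condition for all $x\in\mathrm{hg}(L)$, $y\in L$: - $\mathrm{GDer}_{\alpha^k}(L)$ (generalized $\alpha^k$-derivations): there exist $D',D''\in\mathrm{End}_\theta(L)$ commuting with $\alpha$ such that $[D(x),\alpha^k(y)]+(-1)^{\theta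 x}[\alpha^k(x),D'(y)]=D''([x,y])$. - $\mathrm{QDer}_{\alpha^k}(L)$ ($\alpha^k$-quasiderivations): there exists $D'\in\mathrm{End}_\theta(L)$ commuting with $\alpha$ such that $[D(x),\alpha^k(y)]+(-1)^{\theta x}[\alpha^k(x),D(y)]=D'([x,y])$. - $\mathrm{QC}_{\alpha^k}(L)$ ($\alpha^k$-quasicentroid): $[D(x),\alpha^k(y)]=(-1)^{\theta x}[\alpha^k(x),D(y)]$. For $X\in\{\mathrm{GDer},\mathrm{QDer},\mathrm{QC}\}$ put $X(L)=\bigoplus_{k\ge0}X_{\alpha^k}(L)$, a direct sum indexed by $k$; the sum $\mathrm{QDer}(L)+\mathrm{QC}(L)$ is formed summand by summand in $k$. *)

theory Defs
  imports
    Complex_Main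
    "HOL-Library.Z2"
    "HOL-Library.Function_Algebras"
    "HOL-Library.Set_Algebras"
    "HOL-Library.Poly_Mapping"
begin

text \<open>
  Degrees are elements of the two-element field \<^typ>\<open>bit\<close>, so that addition and multiplication
  of degrees are those of the ring of integers modulo 2, and the sign \<open>(-1)\<^sup>x\<^sup>y\<close> for
  homogeneous \<open>x\<close>, \<open>y\<close> of degrees \<open>i\<close>, \<open>j\<close> is \<open>parity_sign (i * j)\<close>.
\<close>

definition parity_sign :: "bit \<Rightarrow> 'k::field" where
  "parity_sign d = (if d = 0 then 1 else - 1)"

locale graded_space = vector_space scale
  for scale :: "'k::field_char_0 \<Rightarrow> 'v::ab_group_add \<Rightarrow> 'v" (infixr "*s" 75) +
  fixes L :: "bit \<Rightarrow> 'v set"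
  assumes subspace_L: "subspace (L i)"
    and L_Int: "L 0 \<inter> L 1 = {0}"
    and L_sum: "L 0 + L 1 = UNIV"
begin

definition End :: "bit \<Rightarrow> ('v \<Rightarrow> 'v) set" where
  "End \<theta> = {D. Vector_Spaces.linear (*s) (*s) D \<and> (\<forall>i. \<forall>x\<in>L i. D x \<in> L (\<theta> + i))}"

end

text \<open>The pointwise vector space structure on maps; the span of a set of linear maps taken in
  this space consists of linear maps.\<close>

sublocale graded_space \<subseteq> Maps: vector_space "\<lambda>c (D :: 'v \<Rightarrow> 'v) x. c *s D x"
  by unfold_locales
    (auto simp: fun_eq_iff scale_right_distrib scale_left_distrib)

locale hom_lie_superalgebra = graded_space scale L
  for scale :: "'k::field_char_0 \<Rightarrow> 'v::ab_group_add \<Rightarrow> 'v" (infixr "*s" 75)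
    and L :: "bit \<Rightarrow> 'v set" +
  fixes bracket :: "'v \<Rightarrow> 'v \<Rightarrow> 'v"
    and \<alpha> :: "'v \<Rightarrow> 'v"
  assumes linear_bracket_left: "Vector_Spaces.linear (*s) (*s) (\<lambda>x. bracket x y)"
    and linear_bracket_right: "Vector_Spaces.linear (*s) (*s) (bracket x)"
    and even_bracket: "\<lbrakk>x \<in> L i; y \<in> L j\<rbrakk> \<Longrightarrow> bracket x y \<in> L (i + j)"
    and even_linear_\<alpha>: "\<alpha> \<in> End 0"
    and skew: "\<lbrakk>x \<in> L i; y \<in> L j\<rbrakk> \<Longrightarrow>
      bracket x y = - (parity_sign (i * j) *s bracket y x)"
    and hom_jacobi: "\<lbrakk>x \<in> L i; y \<in> L j; z \<in> L l\<rbrakk> \<Longrightarrow>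
        parity_sign (l * i) *s bracket (\<alpha> x) (bracket y z)
      + parity_sign (i * j) *s bracket (\<alpha> y) (bracket z x)
      + parity_sign (j * l) *s bracket (\<alpha> z) (bracket x y) = 0"

locale multiplicative_hom_lie_superalgebra = hom_lie_superalgebra +
  assumes multiplicative: "\<alpha> (bracket x y) = bracket (\<alpha> x) (\<alpha> y)"

text \<open>
  The direct sum of the spaces \<open>X k\<close>, indexed by \<open>k\<close>, as the finitely supported families
  with \<open>k\<close>-th member in \<open>X k\<close>. This is an external direct sum: one map may lie in several
  of the \<open>X k\<close>, and these occurrences are kept apart.
\<close>

definition direct_sum :: "(nat \<Rightarrow> 'm::zero set) \<Rightarrow> (nat \<Rightarrow>\<^sub>0 'm) set" where
  "direct_sum X = {F. \<forall>k. Poly_Mapping.lookup F k \<in> X k}"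

text \<open>Hence the sum of two direct sums is formed summand by summand.\<close>

lemma direct_sum_plus:
  fixes X Y :: "nat \<Rightarrow> 'm::comm_monoid_add set"
  assumes "\<And>k. 0 \<in> X k" and "\<And>k. 0 \<in> Y k"
  shows "direct_sum X + direct_sum Y = direct_sum (\<lambda>k. X k + Y k)"
proof (intro equalityI subsetI)
  fix F assume "F \<in> direct_sum X + direct_sum Y"
  then obtain G H where "F = G + H" "G \<in> direct_sum X" "H \<in> direct_sum Y"
    by (rule set_plus_elim)
  then show "F \<in> direct_sum (\<lambda>k. X k + Y k)"
    unfolding direct_sum_def lookup_add mem_Collect_eq by (simp add: lookup_add set_plus_intro)
next
  fix F assume "F \<in> direct_sum (\<lambda>k. X k + Y k)"
  then have "\<exists>a b. a \<in> X k \<and> b \<in> Y k \<and> Poly_Mapping.lookup F k = a + b" for k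
    by (force simp: direct_sum_def elim: set_plus_elim)
  then obtain a b where ab: "\<And>k. a k \<in> X k" "\<And>k. b k \<in> Y k" "\<And>k. Poly_Mapping.lookup F k = a k + b k"
    by metis
  define A where "A = Abs_poly_mapping (\<lambda>k. if k \<in> Poly_Mapping.keys F then a k else 0)"
  define B where "B = Abs_poly_mapping (\<lambda>k. if k \<in> Poly_Mapping.keys F then b k else 0)"
  have A: "Poly_Mapping.lookup A k = (if k \<in> Poly_Mapping.keys F then a k else 0)" for k
    unfolding A_def by (subst Abs_poly_mapping_inverse) (auto intro: finite_subset[of _ "Poly_Mapping.keys F"])
  have B: "Poly_Mapping.lookup B k = (if k \<in> Poly_Mapping.keys F then b k else 0)" for k
    unfolding B_def by (subst Abs_poly_mapping_inverse) (auto intro: finite_subset[of _ "Poly_Mapping.keys F"])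
  have "F = A + B"
    using ab(3) by (intro poly_mapping_eqI) (simp add: lookup_add A B in_keys_iff)
  moreover have "A \<in> direct_sum X" "B \<in> direct_sum Y"
    using ab assms by (auto simp: direct_sum_def A B)
  ultimately show "F \<in> direct_sum X + direct_sum Y"
    by auto
qed

context hom_lie_superalgebra
begin

text \<open>\<open>\<alpha>\<^sup>k\<close> is the iterate \<open>\<alpha> ^^ k\<close>; the operator \<open>^\<close> on maps would be the pointwise power.\<close>

definition GDer_at :: "nat \<Rightarrow> ('v \<Rightarrow> 'v) set" where
  "GDer_at k = Maps.span {D. \<exists>\<theta>. D \<in> End \<theta> \<and> D \<circ> \<alpha> = \<alpha> \<circ> D \<and>
     (\<exists>D'\<in>End \<theta>. \<exists>D''\<in>End \<theta>. D' \<circ> \<alpha> = \<alpha> \<circ> D' \<and> D'' \<circ> \<alpha> = \<alpha> \<circ> D'' \<and>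
       (\<forall>i. \<forall>x\<in>L i. \<forall>y.
          bracket (D x) ((\<alpha> ^^ k) y) + parity_sign (\<theta> * i) *s bracket ((\<alpha> ^^ k) x) (D' y)
            = D'' (bracket x y)))}"

definition QDer_at :: "nat \<Rightarrow> ('v \<Rightarrow> 'v) set" where
  "QDer_at k = Maps.span {D. \<exists>\<theta>. D \<in> End \<theta> \<and> D \<circ> \<alpha> = \<alpha> \<circ> D \<and>
     (\<exists>D'\<in>End \<theta>. D' \<circ> \<alpha> = \<alpha> \<circ> D' \<and>
       (\<forall>i. \<forall>x\<in>L i. \<forall>y.
          bracket (D x) ((\<alpha> ^^ k) y) + parity_sign (\<theta> * i) *s bracket ((\<alpha> ^^ k) x) (D y)
            = D' (bracket x y)))}"

definition QC_at :: "nat \<Rightarrow> ('v \<Rightarrow> 'v) set" where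
  "QC_at k = Maps.span {D. \<exists>\<theta>. D \<in> End \<theta> \<and> D \<circ> \<alpha> = \<alpha> \<circ> D \<and>
     (\<forall>i. \<forall>x\<in>L i. \<forall>y.
        bracket (D x) ((\<alpha> ^^ k) y) = parity_sign (\<theta> * i) *s bracket ((\<alpha> ^^ k) x) (D y))}"

definition GDer :: "(nat \<Rightarrow>\<^sub>0 ('v \<Rightarrow> 'v)) set" where
  "GDer = direct_sum GDer_at"

definition QDer :: "(nat \<Rightarrow>\<^sub>0 ('v \<Rightarrow> 'v)) set" where
  "QDer = direct_sum QDer_at"

definition QC :: "(nat \<Rightarrow>\<^sub>0 ('v \<Rightarrow> 'v)) set" where
  "QC = direct_sum QC_at"

end

end

theory Submission
  imports Defs
begin

text \<open>
  Let \<open>D\<close> be homogeneous of degree \<open>\<theta>\<close> with companions \<open>D'\<close>, \<open>D''\<close> as in the definition of a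
  generalized \<open>\<alpha>\<^sup>k\<close>-derivation. Exchanging \<open>x\<close> and \<open>y\<close> and applying skew-supersymmetry shows that
  \<open>D'\<close> is a generalized derivation with companions \<open>D\<close>, \<open>D''\<close>. Half the sum of the two identities
  says that \<open>(D + D') / 2\<close> is a quasiderivation, and half their difference says that
  \<open>(D - D') / 2\<close> lies in the quasicentroid; these two maps add up to \<open>D\<close>. Conversely, an element
  \<open>D\<close> of the quasicentroid is a generalized derivation with companions \<open>-D\<close> and \<open>0\<close>.
\<close>

section \<open>Homogeneous linear maps on a graded space\<close>

context graded_space
begin

lemma homogeneous_decomposition:
  obtains a b where "a \<in> L 0" "b \<in> L 1" "x = a + b"
proof -
  have "x \<in> L 0 + L 1" by (simp add: L_sum)
  then show thesis by (rule set_plus_elim) (rule that)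
qed

lemma linear_iff_add_scale:
  "Vector_Spaces.linear (*s) (*s) D \<longleftrightarrow>
     (\<forall>x y. D (x + y) = D x + D y) \<and> (\<forall>c x. D (c *s x) = c *s D x)"
  by (simp add: Vector_Spaces.linear_iff vector_space_axioms)

lemma End_linear: "D \<in> End \<theta> \<Longrightarrow> Vector_Spaces.linear (*s) (*s) D"
  by (simp add: End_def)

lemma End_homogeneous: "D \<in> End \<theta> \<Longrightarrow> x \<in> L i \<Longrightarrow> D x \<in> L (\<theta> + i)"
  by (simp add: End_def)

lemma EndI:
  assumes "\<And>x y. D (x + y) = D x + D y" "\<And>c x. D (c *s x) = c *s D x"
    and "\<And>i x. x \<in> L i \<Longrightarrow> D x \<in> L (\<theta> + i)"
  shows "D \<in> End \<theta>"
  using assms unfolding End_def linear_iff_add_scale by blast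

lemma zero_in_End: "0 \<in> End \<theta>"
  by (rule EndI) (simp_all add: subspace_0[OF subspace_L])

lemma add_in_End:
  assumes D: "D \<in> End \<theta>" and E: "E \<in> End \<theta>"
  shows "D + E \<in> End \<theta>"
proof (rule EndI)
  show "(D + E) x \<in> L (\<theta> + i)" if "x \<in> L i" for i x
    unfolding plus_fun_apply
    by (rule subspace_add[OF subspace_L End_homogeneous[OF D that] End_homogeneous[OF E that]])
qed (use End_linear[OF D] End_linear[OF E] in
    \<open>auto simp: linear_iff_add_scale scale_right_distrib\<close>)

lemma scale_in_End:
  assumes D: "D \<in> End \<theta>"
  shows "(\<lambda>x. c *s D x) \<in> End \<theta>"
proof (rule EndI)
  show "c *s D x \<in> L (\<theta> + i)" if "x \<in> L i" for i x
    by (rule subspace_scale[OF subspace_L End_homogeneous[OF D that]])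
qed (use End_linear[OF D] in \<open>auto simp: linear_iff_add_scale scale_right_distrib mult.commute\<close>)

end

section \<open>Bilinearity of the bracket, powers of \<open>\<alpha>\<close>, and maps commuting
  with \<open>\<alpha>\<close>\<close>

context hom_lie_superalgebra
begin

lemma bracket_add_left: "bracket (x + y) z = bracket x z + bracket y z"
  using linear_bracket_left by (simp add: linear_iff_add_scale)

lemma bracket_scale_left: "bracket (c *s x) z = c *s bracket x z"
  using linear_bracket_left by (simp add: linear_iff_add_scale)

lemma bracket_add_right: "bracket x (y + z) = bracket x y + bracket x z"
  using linear_bracket_right by (simp add: linear_iff_add_scale)

lemma bracket_scale_right: "bracket x (c *s z) = c *s bracket x z"
  using linear_bracket_right by (simp add: linear_iff_add_scale)

lemma bracket_minus_right: "bracket x (- y) = - bracket x y"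
  using bracket_scale_right[of x "- 1" y] by simp

lemma \<alpha>_add: "\<alpha> (x + y) = \<alpha> x + \<alpha> y"
  and \<alpha>_scale: "\<alpha> (c *s x) = c *s \<alpha> x"
  using even_linear_\<alpha> by (simp_all add: End_def linear_iff_add_scale)

lemma funpow_\<alpha>_add: "(\<alpha> ^^ k) (x + y) = (\<alpha> ^^ k) x + (\<alpha> ^^ k) y"
  by (induction k) (simp_all add: \<alpha>_add)

lemma funpow_\<alpha>_homogeneous: "x \<in> L i \<Longrightarrow> (\<alpha> ^^ k) x \<in> L i"
proof (induction k)
  case (Suc k)
  then show ?case
    using End_homogeneous[OF even_linear_\<alpha>, of "(\<alpha> ^^ k) x" i]
    by (simp only: funpow.simps o_apply add_0)
qed simp

definition commuting_End :: "bit \<Rightarrow> ('v \<Rightarrow> 'v) set" where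
  "commuting_End \<theta> = {D \<in> End \<theta>. D \<circ> \<alpha> = \<alpha> \<circ> D}"

lemma zero_in_commuting_End: "0 \<in> commuting_End \<theta>"
  \<comment> \<open>The scalar 0 gives \<open>\<alpha> 0 = 0\<close>, so the zero map commutes with
    \<open>\<alpha>\<close>.\<close>
  using \<alpha>_scale[of 0] by (auto simp: commuting_End_def zero_in_End)

lemma add_in_commuting_End:
  "D \<in> commuting_End \<theta> \<Longrightarrow> E \<in> commuting_End \<theta> \<Longrightarrow> D + E \<in> commuting_End \<theta>"
  by (auto simp: commuting_End_def add_in_End fun_eq_iff \<alpha>_add)

lemma scale_in_commuting_End:
  "D \<in> commuting_End \<theta> \<Longrightarrow> (\<lambda>x. c *s D x) \<in> commuting_End \<theta>"
  by (auto simp: commuting_End_def scale_in_End fun_eq_iff \<alpha>_scale)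

lemma minus_in_commuting_End: "D \<in> commuting_End \<theta> \<Longrightarrow> - D \<in> commuting_End \<theta>"
  using scale_in_commuting_End[of D \<theta> "- 1"] by (simp add: fun_Compl_def)

text \<open>One predicate covers the generators of all three spaces: arbitrary \<open>D'\<close> and
  \<open>D''\<close> for \<open>GDer_at\<close>, \<open>D' = D\<close> for \<open>QDer_at\<close>,
  and \<open>D' = - D\<close> with \<open>D'' = 0\<close> for \<open>QC_at\<close>. For fixed
  \<open>k\<close> and \<open>\<theta>\<close> the identity is linear in the triple, so such triples
  can be added and scaled.\<close>

definition ternary_derivation ::
    "nat \<Rightarrow> bit \<Rightarrow> ('v \<Rightarrow> 'v) \<Rightarrow> ('v \<Rightarrow> 'v) \<Rightarrow> ('v \<Rightarrow> 'v) \<Rightarrow> bool" where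
  "ternary_derivation k \<theta> D D' D'' \<longleftrightarrow>
     D \<in> commuting_End \<theta> \<and> D' \<in> commuting_End \<theta> \<and> D'' \<in> commuting_End \<theta> \<and>
     (\<forall>i. \<forall>x\<in>L i. \<forall>y.
        bracket (D x) ((\<alpha> ^^ k) y) + parity_sign (\<theta> * i) *s bracket ((\<alpha> ^^ k) x) (D' y)
          = D'' (bracket x y))"

lemma ternary_derivation_add:
  assumes "ternary_derivation k \<theta> D D' D''" "ternary_derivation k \<theta> E E' E''"
  shows "ternary_derivation k \<theta> (D + E) (D' + E') (D'' + E'')"
  unfolding ternary_derivation_def
proof (intro conjI allI ballI)
  fix i x y assume x: "x \<in> L i"
  have "bracket ((D + E) x) ((\<alpha> ^^ k) y)
        + parity_sign (\<theta> * i) *s bracket ((\<alpha> ^^ k) x) ((D' + E') y)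
      = (bracket (D x) ((\<alpha> ^^ k) y) + parity_sign (\<theta> * i) *s bracket ((\<alpha> ^^ k) x) (D' y))
        + (bracket (E x) ((\<alpha> ^^ k) y) + parity_sign (\<theta> * i) *s bracket ((\<alpha> ^^ k) x) (E' y))"
    by (simp add: bracket_add_left bracket_add_right scale_right_distrib)
  also have "\<dots> = (D'' + E'') (bracket x y)"
    using assms x by (simp add: ternary_derivation_def)
  finally show "bracket ((D + E) x) ((\<alpha> ^^ k) y)
      + parity_sign (\<theta> * i) *s bracket ((\<alpha> ^^ k) x) ((D' + E') y) = (D'' + E'') (bracket x y)" .
qed (use assms in \<open>auto simp: ternary_derivation_def add_in_commuting_End\<close>)

lemma ternary_derivation_scale:
  assumes "ternary_derivation k \<theta> D D' D''"
  shows "ternary_derivation k \<theta> (\<lambda>x. c *s D x) (\<lambda>x. c *s D' x) (\<lambda>x. c *s D'' x)"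
  unfolding ternary_derivation_def
proof (intro conjI allI ballI)
  fix i x y assume x: "x \<in> L i"
  have "bracket (c *s D x) ((\<alpha> ^^ k) y)
        + parity_sign (\<theta> * i) *s bracket ((\<alpha> ^^ k) x) (c *s D' y)
      = c *s (bracket (D x) ((\<alpha> ^^ k) y)
        + parity_sign (\<theta> * i) *s bracket ((\<alpha> ^^ k) x) (D' y))"
    by (simp add: bracket_scale_left bracket_scale_right scale_right_distrib mult.commute)
  also have "\<dots> = c *s D'' (bracket x y)"
    using assms x by (simp add: ternary_derivation_def)
  finally show "bracket (c *s D x) ((\<alpha> ^^ k) y)
      + parity_sign (\<theta> * i) *s bracket ((\<alpha> ^^ k) x) (c *s D' y) = c *s D'' (bracket x y)" .
qed (use assms in \<open>auto simp: ternary_derivation_def scale_in_commuting_End\<close>)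

lemma ternary_derivation_swap:
  assumes "ternary_derivation k \<theta> D D' D''"
  shows "ternary_derivation k \<theta> D' D D''"
proof -
  have End: "D \<in> End \<theta>" "D' \<in> End \<theta>" "D'' \<in> End \<theta>"
    using assms by (auto simp: ternary_derivation_def commuting_End_def)
  have add: "D (u + v) = D u + D v" "D'' (u + v) = D'' u + D'' v" "D'' (c *s u) = c *s D'' u"
    for u v c
    using End_linear[OF End(1)] End_linear[OF End(3)] by (simp_all add: linear_iff_add_scale)
  have neg: "D'' (- u) = - D'' u" for u
    using add(3)[of "- 1" u] by simp
  \<comment> \<open>Skew-supersymmetry holds only between homogeneous elements, so \<open>y\<close>
    is first taken homogeneous.\<close>
  have hom: "bracket (D' x) ((\<alpha> ^^ k) y) + parity_sign (\<theta> * i) *s bracket ((\<alpha> ^^ k) x) (D y)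
      = D'' (bracket x y)" if x: "x \<in> L i" and y: "y \<in> L j" for i j x y
  proof -
    have "bracket (D' x) ((\<alpha> ^^ k) y)
        = - (parity_sign ((\<theta> + i) * j) *s bracket ((\<alpha> ^^ k) y) (D' x))"
      "bracket ((\<alpha> ^^ k) x) (D y)
        = - (parity_sign (i * (\<theta> + j)) *s bracket (D y) ((\<alpha> ^^ k) x))"
      by (rule skew[OF End_homogeneous[OF End(2) x] funpow_\<alpha>_homogeneous[OF y]],
          rule skew[OF funpow_\<alpha>_homogeneous[OF x] End_homogeneous[OF End(1) y]])
    \<comment> \<open>Modulo 2, the exponents are (\<theta> + i)j = ij + \<theta>j and \<theta>i +
      i(\<theta> + j) = ij. Hence the common sign of ij factors out and leaves the given identity
      for the pair \<open>y\<close>, \<open>x\<close>.\<close>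
    moreover have "parity_sign ((\<theta> + i) * j) = parity_sign (i * j) * (parity_sign (\<theta> * j) :: 'k)"
      "parity_sign (\<theta> * i) * parity_sign (i * (\<theta> + j)) = (parity_sign (i * j) :: 'k)"
      by (cases \<theta>; cases i; cases j; simp add: parity_sign_def)+
    ultimately have "bracket (D' x) ((\<alpha> ^^ k) y)
        + parity_sign (\<theta> * i) *s bracket ((\<alpha> ^^ k) x) (D y)
      = - (parity_sign (i * j) *s (bracket (D y) ((\<alpha> ^^ k) x)
            + parity_sign (\<theta> * j) *s bracket ((\<alpha> ^^ k) y) (D' x)))"
      by (simp add: scale_right_distrib)
    also have "\<dots> = - (parity_sign (i * j) *s D'' (bracket y x))"
      using assms y by (simp add: ternary_derivation_def)
    also have "\<dots> = D'' (bracket x y)"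
      by (simp add: skew[OF x y] add neg)
    finally show ?thesis .
  qed
  \<comment> \<open>Both sides are additive in \<open>y\<close>, so the homogeneous components of an
    arbitrary \<open>y\<close> suffice.\<close>
  have "bracket (D' x) ((\<alpha> ^^ k) y) + parity_sign (\<theta> * i) *s bracket ((\<alpha> ^^ k) x) (D y)
      = D'' (bracket x y)" if x: "x \<in> L i" for i x y
  proof -
    obtain a b where a: "a \<in> L 0" and b: "b \<in> L 1" and y: "y = a + b"
      by (rule homogeneous_decomposition)
    show ?thesis
      by (simp add: y add funpow_\<alpha>_add bracket_add_right scale_right_distrib algebra_simps
          flip: hom[OF x a] hom[OF x b])
  qed
  then show ?thesis
    using assms by (auto simp: ternary_derivation_def)
qed

section \<open>The three spaces as spans of ternary derivations, and their comparison\<close>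

lemma GDer_at_eq: "GDer_at k = Maps.span {D. \<exists>\<theta> D' D''. ternary_derivation k \<theta> D D' D''}"
  unfolding GDer_at_def
  by (rule arg_cong[where f = Maps.span], unfold ternary_derivation_def commuting_End_def) blast

lemma QDer_at_eq: "QDer_at k = Maps.span {D. \<exists>\<theta> D'. ternary_derivation k \<theta> D D D'}"
  unfolding QDer_at_def
  by (rule arg_cong[where f = Maps.span], unfold ternary_derivation_def commuting_End_def) blast

lemma ternary_derivation_quasicentroid_iff:
  "ternary_derivation k \<theta> D (- D) 0 \<longleftrightarrow> D \<in> commuting_End \<theta> \<and>
     (\<forall>i. \<forall>x\<in>L i. \<forall>y.
        bracket (D x) ((\<alpha> ^^ k) y) = parity_sign (\<theta> * i) *s bracket ((\<alpha> ^^ k) x) (D y))"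
  by (auto simp: ternary_derivation_def minus_in_commuting_End zero_in_commuting_End
      bracket_minus_right)

lemma QC_at_eq: "QC_at k = Maps.span {D. \<exists>\<theta>. ternary_derivation k \<theta> D (- D) 0}"
  unfolding QC_at_def ternary_derivation_quasicentroid_iff commuting_End_def
  by (simp add: conj_assoc)

lemma ternary_derivation_split:
  assumes "ternary_derivation k \<theta> D D' D''"
  obtains P Q where "D = P + Q" "ternary_derivation k \<theta> P P D''" "ternary_derivation k \<theta> Q (- Q) 0"
proof
  let ?P = "\<lambda>x. (1/2) *s (D + D') x" and ?Q = "\<lambda>x. (1/2) *s (D + (\<lambda>x. - 1 *s D' x)) x"
  \<comment> \<open>Characteristic zero makes 2 invertible.\<close>
  have half: "(1/2) *s x + (1/2) *s x = x" for x
    by (simp flip: scale_left_distrib)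
  show "D = ?P + ?Q"
    by (auto simp: fun_eq_iff scale_right_distrib half algebra_simps)
  note swap = ternary_derivation_swap[OF assms]
  \<comment> \<open>The triple and its swap share the third map, so their average keeps
    \<open>D''\<close>, while half their difference sends it to 0.\<close>
  have "(\<lambda>x. (1/2) *s (D'' + D'') x) = D''"
    by (auto simp: scale_right_distrib half)
  then show "ternary_derivation k \<theta> ?P ?P D''"
    using ternary_derivation_scale[OF ternary_derivation_add[OF assms swap], of "1/2"]
    by (simp add: add.commute)
  \<comment> \<open>Swapping exchanges \<open>D\<close> and \<open>D'\<close>, so the second map of
    the half difference is the negative of the first.\<close>
  have "(\<lambda>x. (1/2) *s (D' + (\<lambda>x. - 1 *s D x)) x) = - ?Q"
    "(\<lambda>x. (1/2) *s (D'' + (\<lambda>x. - 1 *s D'' x)) x) = 0"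
    by (auto simp: fun_eq_iff scale_right_diff_distrib)
  then show "ternary_derivation k \<theta> ?Q (- ?Q) 0"
    using ternary_derivation_scale[OF
        ternary_derivation_add[OF assms ternary_derivation_scale[OF swap, of "- 1"]], of "1/2"]
    by (simp only:)
qed

text \<open>A sum of two spans is a subspace, so for the first inclusion it is enough to split the
  homogeneous generators. Conversely, the generators of both summands are among those of
  \<open>GDer_at k\<close>.\<close>

lemma GDer_at_eq_QDer_at_plus_QC_at: "GDer_at k = QDer_at k + QC_at k"
proof
  have "{D. \<exists>\<theta> D' D''. ternary_derivation k \<theta> D D' D''} \<subseteq> QDer_at k + QC_at k"
    unfolding QDer_at_eq QC_at_eq
    by (blast elim: ternary_derivation_split intro: Maps.span_base)
  moreover have "QDer_at k + QC_at k = {D + E |D E. D \<in> QDer_at k \<and> E \<in> QC_at k}"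
    by (auto simp: set_plus_def)
  then have "Maps.subspace (QDer_at k + QC_at k)"
    using Maps.subspace_sums[OF Maps.subspace_span Maps.subspace_span]
    by (simp only: QDer_at_eq QC_at_eq)
  ultimately show "GDer_at k \<subseteq> QDer_at k + QC_at k"
    unfolding GDer_at_eq by (rule Maps.span_minimal)
next
  have "QDer_at k \<subseteq> GDer_at k" "QC_at k \<subseteq> GDer_at k"
    unfolding GDer_at_eq QDer_at_eq QC_at_eq by (rule Maps.span_mono; blast)+
  then show "QDer_at k + QC_at k \<subseteq> GDer_at k"
    unfolding GDer_at_eq by (auto elim!: set_plus_elim intro: Maps.span_add)
qed

lemma GDer_eq_QDer_plus_QC: "GDer = QDer + QC"
proof -
  \<comment> \<open>By \<open>direct_sum_plus\<close> the sum is formed for each \<open>k\<close>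
    separately; membership of 0 allows the chosen components to be set to 0 outside the finite
    support of a family.\<close>
  have "0 \<in> QDer_at k" "0 \<in> QC_at k" for k
    unfolding QDer_at_eq QC_at_eq by (rule Maps.span_zero)+
  then show ?thesis
    unfolding GDer_def QDer_def QC_def
    by (simp add: direct_sum_plus flip: GDer_at_eq_QDer_at_plus_QC_at)
qed

end

theorem theorem2p3:
  fixes scale :: "'k::field_char_0 \<Rightarrow> 'v::ab_group_add \<Rightarrow> 'v"
    and L :: "bit \<Rightarrow> 'v set"
    and bracket :: "'v \<Rightarrow> 'v \<Rightarrow> 'v"
    and \<alpha> :: "'v \<Rightarrow> 'v"
  assumes "multiplicative_hom_lie_superalgebra scale L bracket \<alpha>"
  shows "hom_lie_superalgebra.GDer scale L bracket \<alpha>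
       = hom_lie_superalgebra.QDer scale L bracket \<alpha> + hom_lie_superalgebra.QC scale L bracket \<alpha>"
  using assms
  by (intro hom_lie_superalgebra.GDer_eq_QDer_plus_QC)
    (rule multiplicative_hom_lie_superalgebra.axioms(1))

end
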